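(* Suppose that $f$ is a $C^{1}$ circle endomorphism and suppose that $f$ is Hölder conjugate to a topologically expanding circle endomorphism $g$. Then $f$ itself is expanding.
   Context: $T=\{z\in\mathbb{C}: |z|=1\}$. A circle endomorphism is an orientation-preserving covering map $f:T\to T$ of degree $d\ge 2$, assumed to satisfy $f(1)=1$. Its lift is the orientation-preserving homeomorphism $F:\mathbb{R}\to\mathbb{R}$ with $F(0)=0$, $F(x+1)=F(x)+d$ and $e^{2\pi i F(x)}=f(e^{2\pi i x})$; $G$ denotes the lift of $g$. The map $f$ is $C^{1}$ if $F'$ exists and is continuous. A $C^1$ circle endomorphism $f$ is called expanding if there are constants $C>0$ and $\lambda>1$ with $(F^{n})'(x)\ge C\lambda^{n}$ for all $x\in\mathbb{R}$ and $n=1,2,\dots$. A circle homeomorphism is an orientation-preserving homeomorphism $h:T\to T$; its lift is the homeomorphism $H:\mathbb{R}\to\mathbb{R}$ with $H(x+1)=H(x)+1$, $0\le H(0)<1$ and $e^{2\pi i H(x)}=h(e^{2\pi i x})$. It is called Hölder if there is a constant $0<\alpha\le 1$ such that $\sup_{x\neq y}|H(x)-H(y)|/|x-y|^{\alpha}<\infty$, the supremum being over $x\ne y$ in $[0,1]$. A circle endomorphism $f$ is Hölder conjugate to a circle endomorphism $g$ if there is a Hölder circle homeomorphism $h$ with $f\circ h=h\circ g$. A circle endomorphism $g$ is called topologically expanding if there are constants $C>0$ and $\lambda>1$ with $|G^{n}(x)-G^{n}(y)|\ge C\lambda^{n}|x-y|$ for all $x,y\in[0,1]$ and all $n\ge 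0$.
   Formalization: The formal theorem additionally assumes that the derivative F' of the lift of f vanishes nowhere; without this the claim is false (a C^1 f Lipschitz conjugate to z^2 can have F'(1/2)=0), and being expanding implies it. *)

theory Defs
  imports "HOL-Analysis.Analysis"
begin

text \<open>
  The circle is \<open>sphere 0 1\<close> in the complex plane. Circle maps are total functions on
  \<^typ>\<open>complex\<close>; their values off the circle are never used.
\<close>

abbreviation unit_circle :: "complex set" where
  "unit_circle \<equiv> sphere 0 1"

definition is_endo_lift :: "nat \<Rightarrow> (complex \<Rightarrow> complex) \<Rightarrow> (real \<Rightarrow> real) \<Rightarrow> bool" where
  "is_endo_lift d f F \<longleftrightarrow>
     (\<exists>K. homeomorphism UNIV UNIV F K) \<and> strict_mono F \<and> F 0 = 0 \<and>
     (\<forall>x. F (x + 1) = F x + real d) \<and>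
     (\<forall>x. cis (2 * pi * F x) = f (cis (2 * pi * x)))"

text \<open>
  The degree and the preservation of orientation are read off the lift: a covering map of degree
  \<open>d > 0\<close> is orientation preserving iff it has a strictly increasing lift with
  \<open>F (x + 1) = F x + d\<close>.
\<close>

definition circle_endomorphism :: "(complex \<Rightarrow> complex) \<Rightarrow> bool" where
  "circle_endomorphism f \<longleftrightarrow>
     covering_space unit_circle f unit_circle \<and> f 1 = 1 \<and>
     (\<exists>d\<ge>2. \<exists>F. is_endo_lift d f F)"

definition endo_lift :: "(complex \<Rightarrow> complex) \<Rightarrow> real \<Rightarrow> real" where
  "endo_lift f = (THE F. \<exists>d. is_endo_lift d f F)"

definition is_homeo_lift :: "(complex \<Rightarrow> complex) \<Rightarrow> (real \<Rightarrow> real) \<Rightarrow> bool" where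
  "is_homeo_lift h H \<longleftrightarrow>
     (\<exists>K. homeomorphism UNIV UNIV H K) \<and>
     (\<forall>x. H (x + 1) = H x + 1) \<and> 0 \<le> H 0 \<and> H 0 < 1 \<and>
     (\<forall>x. cis (2 * pi * H x) = h (cis (2 * pi * x)))"

text \<open>
  Here too orientation is read off the lift: for an orientation-reversing homeomorphism every
  continuous lift satisfies \<open>H (x + 1) = H x - 1\<close>.
\<close>

definition circle_homeomorphism :: "(complex \<Rightarrow> complex) \<Rightarrow> bool" where
  "circle_homeomorphism h \<longleftrightarrow>
     (\<exists>k. homeomorphism unit_circle unit_circle h k) \<and> (\<exists>H. is_homeo_lift h H)"

definition homeo_lift :: "(complex \<Rightarrow> complex) \<Rightarrow> real \<Rightarrow> real" where
  "homeo_lift h = (THE H. is_homeo_lift h H)"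

text \<open>Lifts are unique, so the two definite descriptions are well defined.\<close>

lemma continuous_lift_unique:
  fixes F G :: "real \<Rightarrow> real"
  assumes "continuous_on UNIV F" "continuous_on UNIV G"
    and eq: "\<And>x. cis (2 * pi * F x) = cis (2 * pi * G x)"
    and 0: "\<bar>F 0 - G 0\<bar> < 1"
  shows "F = G"
proof -
  have int: "F x - G x \<in> \<int>" for x
  proof -
    have "cis (2 * pi * F x - 2 * pi * G x) = 1"
      by (simp add: cis_divide [symmetric] eq)
    then have "cos (2 * pi * F x - 2 * pi * G x) = 1"
      by (simp add: complex_eq_iff)
    then obtain n :: int where "2 * pi * F x - 2 * pi * G x = of_int n * (2 * pi)"
      by (auto simp: cos_one_2pi_int)
    then have "2 * pi * (F x - G x) = 2 * pi * of_int n"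
      by (simp add: algebra_simps)
    then have "F x - G x = of_int n"
      by simp
    then show ?thesis by simp
  qed
  have "(\<lambda>x. F x - G x) constant_on UNIV"
  proof (rule continuous_discrete_range_constant)
    show "continuous_on UNIV (\<lambda>x. F x - G x)"
      using assms by (intro continuous_intros)
    fix x
    show "\<exists>e>0. \<forall>y. y \<in> UNIV \<and> F y - G y \<noteq> F x - G x \<longrightarrow>
            e \<le> norm (F y - G y - (F x - G x))"
    proof (intro exI [of _ 1] conjI allI impI)
      fix y assume "y \<in> UNIV \<and> F y - G y \<noteq> F x - G x"
      moreover have "F y - G y - (F x - G x) \<in> \<int>"
        using int by (blast intro: Ints_diff)
      ultimately show "1 \<le> norm (F y - G y - (F x - G x))"
        by (simp add: Ints_nonzero_abs_ge1)
    qed simp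
  qed simp
  moreover have "F 0 - G 0 = 0"
    using int [of 0] 0 Ints_nonzero_abs_ge1 by fastforce
  ultimately show ?thesis
    unfolding constant_on_def by (metis UNIV_I eq_iff_diff_eq_0 ext)
qed

lemma endo_lift_eqI:
  assumes "is_endo_lift d f F" shows "endo_lift f = F"
  unfolding endo_lift_def
proof (rule the_equality)
  show "\<exists>d. is_endo_lift d f F" using assms by blast
next
  fix G assume "\<exists>d. is_endo_lift d f G"
  with assms show "G = F"
    by (intro continuous_lift_unique) (auto simp: is_endo_lift_def homeomorphism_def)
qed

lemma homeo_lift_eqI:
  assumes "is_homeo_lift h H" shows "homeo_lift h = H"
  unfolding homeo_lift_def
proof (rule the_equality)
  show "is_homeo_lift h H" by fact
next
  fix G assume "is_homeo_lift h G"
  with assms show "G = H"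
    by (intro continuous_lift_unique) (auto simp: is_homeo_lift_def homeomorphism_def)
qed

text \<open>
  Being \<open>C\<^sup>1\<close> does not by itself exclude critical points. For instance, let \<open>H\<close> be the extension of
  \<open>\<lambda>t. 10 * t ^ 3 - 15 * t ^ 4 + 6 * t ^ 5\<close> from the unit interval by \<open>H (x + 1) = H x + 1\<close>, whose
  derivative \<open>30 * t\<^sup>2 * (1 - t)\<^sup>2\<close> vanishes exactly at the integers. Then \<open>F (H x) = H (2 * x)\<close>
  defines the lift of a \<open>C\<^sup>1\<close> circle endomorphism with \<open>F' (1/2) = 0\<close>, which is conjugate to
  \<open>z \<mapsto> z\<^sup>2\<close> by a Lipschitz homeomorphism. A statement about \<open>C\<^sup>1\<close> covering maps in the sense of
  local diffeomorphisms has to assume in addition that the derivative of the lift has no zeros.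
\<close>

definition C1_circle_endomorphism :: "(complex \<Rightarrow> complex) \<Rightarrow> bool" where
  "C1_circle_endomorphism f \<longleftrightarrow>
     circle_endomorphism f \<and> endo_lift f C1_differentiable_on UNIV"

definition expanding :: "(complex \<Rightarrow> complex) \<Rightarrow> bool" where
  "expanding f \<longleftrightarrow> C1_circle_endomorphism f \<and>
     (\<exists>C>0. \<exists>l>1. \<forall>x. \<forall>n\<ge>1. C * l ^ n \<le> deriv (endo_lift f ^^ n) x)"

definition topologically_expanding :: "(complex \<Rightarrow> complex) \<Rightarrow> bool" where
  "topologically_expanding g \<longleftrightarrow> circle_endomorphism g \<and>
     (\<exists>C>0. \<exists>l>1. \<forall>x\<in>{0..1}. \<forall>y\<in>{0..1}. \<forall>n.
        C * l ^ n * \<bar>x - y\<bar> \<le> \<bar>(endo_lift g ^^ n) x - (endo_lift g ^^ n) y\<bar>)"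

definition holder_homeomorphism :: "(complex \<Rightarrow> complex) \<Rightarrow> bool" where
  "holder_homeomorphism h \<longleftrightarrow> circle_homeomorphism h \<and>
     (\<exists>\<alpha>. 0 < \<alpha> \<and> \<alpha> \<le> 1 \<and>
        bdd_above {\<bar>homeo_lift h x - homeo_lift h y\<bar> / \<bar>x - y\<bar> powr \<alpha> | x y.
                     x \<in> {0..1} \<and> y \<in> {0..1} \<and> x \<noteq> y})"

definition holder_conjugate :: "(complex \<Rightarrow> complex) \<Rightarrow> (complex \<Rightarrow> complex) \<Rightarrow> bool" where
  "holder_conjugate f g \<longleftrightarrow>
     (\<exists>h. holder_homeomorphism h \<and> (\<forall>z\<in>unit_circle. f (h z) = h (g z)))"

end

theory Submission
  imports Defs
begin

text \<open>
  The lifts satisfy \<open>F\<^sup>n (H x) = H (G\<^sup>n x) + k\<^sub>n\<close> with \<open>k\<^sub>n\<close> an integer. Expansion of \<open>G\<close> and the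
  Hoelder bound on \<open>H\<close> therefore show that an interval whose image under \<open>F\<^sup>n\<close> has length at most
  \<open>1\<close> has length at most \<open>B r\<^sup>n\<close> for some \<open>r < 1\<close>. Choosing \<open>F\<^sup>n v = F\<^sup>n x + 1\<close>, the mean value
  theorem gives a point \<open>y\<close> between \<open>x\<close> and \<open>v\<close> with \<open>(F\<^sup>n)' y \<ge> 1 / (B r\<^sup>n)\<close>. The distances
  between the first \<open>n\<close> iterates of \<open>x\<close> and \<open>y\<close> are at most \<open>B r\<^sup>n, \<dots>, B r\<close>, so by uniform
  continuity of \<open>F'\<close> all but boundedly many factors of \<open>(F\<^sup>n)' y / (F\<^sup>n)' x\<close> are at most
  \<open>q = 1 / sqrt r\<close>. Hence the distortion is at most \<open>K q\<^sup>n\<close> and \<open>(F\<^sup>n)' x \<ge> q\<^sup>n / (B K)\<close>.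
\<close>

section \<open>Quasiperiodic functions\<close>

text \<open>Applied with \<open>c\<close> equal to \<open>real d\<close> or 1 for lifts and to 0 for
  periodic functions.\<close>

lemma quasiperiodic_add_int:
  fixes F :: "real \<Rightarrow> real"
  assumes "\<And>x. F (x + 1) = F x + c"
  shows "F (x + of_int m) = F x + c * of_int m"
proof -
  interpret periodic_fun_simple' "\<lambda>x. F x - c * x"
    by unfold_locales (simp add: assms algebra_simps)
  show ?thesis
    using plus_of_int [of x m] by (simp add: algebra_simps)
qed

lemma quasiperiodic_funpow_add_int:
  fixes F :: "real \<Rightarrow> real"
  assumes "\<And>x. F (x + 1) = F x + real d"
  shows "(F ^^ n) (x + of_int m) = (F ^^ n) x + real d ^ n * of_int m"
proof (induction n)
  case (Suc n)
  have "F ((F ^^ n) x + of_int (int d ^ n * m)) = F ((F ^^ n) x) + real d * of_int (int d ^ n * m)"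
    using quasiperiodic_add_int [of F "real d"] assms by blast
  then show ?case
    using Suc by (simp add: algebra_simps)
qed simp

lemma strict_mono_funpow:
  fixes F :: "'a::order \<Rightarrow> 'a"
  assumes "strict_mono F"
  shows "strict_mono (F ^^ n)"
  by (induction n) (use assms in \<open>auto simp: strict_mono_def\<close>)

lemma periodic_continuous_attains_inf:
  fixes D :: "real \<Rightarrow> real"
  assumes "continuous_on UNIV D" and "\<And>x. D (x + 1) = D x"
  shows "\<exists>x. \<forall>y. D x \<le> D y"
proof -
  have "\<exists>x\<in>{0..1}. \<forall>y\<in>{0..1}. D x \<le> D y"
    by (rule continuous_attains_inf) (auto intro: continuous_on_subset [OF assms(1)])
  then obtain x where x: "\<forall>y\<in>{0..1}. D x \<le> D y"
    by blast
  have "D x \<le> D y" for y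
  proof -
    have "D x \<le> D (frac y)"
      using x frac_ge_0 [of y] frac_lt_1 [of y] by simp
    also have "D (frac y) = D y"
      using quasiperiodic_add_int [of D 0 "frac y" "\<lfloor>y\<rfloor>"] assms(2) by (simp add: frac_def)
    finally show ?thesis .
  qed
  then show ?thesis by blast
qed

lemma periodic_continuous_imp_uniformly_continuous:
  fixes D :: "real \<Rightarrow> real"
  assumes cont: "continuous_on UNIV D" and per: "\<And>x. D (x + 1) = D x" and "e > 0"
  shows "\<exists>\<delta>>0. \<forall>x y. x \<le> y \<and> y - x < \<delta> \<longrightarrow> \<bar>D y - D x\<bar> < e"
proof -
  \<comment> \<open>On \<open>{0..2}\<close> rather than \<open>{0..1}\<close>: two points less than
    1 apart fit into it after a shift by one common integer.\<close>
  have "uniformly_continuous_on {0..2} D"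
    by (rule compact_uniformly_continuous) (auto intro: continuous_on_subset [OF cont])
  then obtain \<delta> where \<delta>: "\<delta> > 0"
    "\<And>x y. x \<in> {0..2} \<Longrightarrow> y \<in> {0..2} \<Longrightarrow> dist y x < \<delta> \<Longrightarrow> dist (D y) (D x) < e"
    using \<open>e > 0\<close> unfolding uniformly_continuous_on_def by metis
  have "\<bar>D y - D x\<bar> < e" if "x \<le> y" "y - x < min \<delta> 1" for x y
  proof -
    define m where "m = \<lfloor>x\<rfloor>"
    have m: "of_int m \<le> x" "x < of_int m + 1"
      by (auto simp: m_def)
    have "dist (D (y - of_int m)) (D (x - of_int m)) < e"
      by (rule \<delta>(2)) (use that m in \<open>auto simp: dist_real_def\<close>)
    moreover have "D (z - of_int m) = D z" for z
      using quasiperiodic_add_int [of D 0 "z - of_int m" m] per by simp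
    ultimately show ?thesis
      by (simp add: dist_real_def)
  qed
  with \<delta>(1) show ?thesis
    by (intro exI [of _ "min \<delta> 1"]) auto
qed

section \<open>Subexponential distortion\<close>

lemma funpow_has_real_derivative:
  fixes F D :: "real \<Rightarrow> real"
  assumes "\<And>x. (F has_real_derivative D x) (at x)"
  shows "((F ^^ n) has_real_derivative (\<Prod>i<n. D ((F ^^ i) x))) (at x)"
proof (induction n)
  case (Suc n)
  have "(F \<circ> (F ^^ n) has_real_derivative D ((F ^^ n) x) * (\<Prod>i<n. D ((F ^^ i) x))) (at x)"
    by (rule DERIV_chain [OF assms Suc])
  then show ?case
    by (simp add: mult.commute comp_def)
qed (auto simp: id_def)

text \<open>Since \<open>D\<close> comes without a modulus of continuity, the ratio of the products
  is allowed to grow like \<open>q ^ n\<close>. Any \<open>q > 1\<close> will do, with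
  \<open>K\<close> depending on it.\<close>

lemma contracting_branches_imp_distortion:
  fixes F D :: "real \<Rightarrow> real"
  assumes cont: "continuous_on UNIV D" and per: "\<And>x. D (x + 1) = D x"
    and pos: "\<And>x. D x > 0"
    and mono: "mono F"
    and contr: "\<And>n u v. u \<le> v \<Longrightarrow> (F ^^ n) v - (F ^^ n) u \<le> 1 \<Longrightarrow> v - u \<le> B * r ^ n"
    and r: "0 < r" "r < 1" and B: "B > 0" and q: "q > 1"
  shows "\<exists>K>0. \<forall>n x y. x \<le> y \<and> (F ^^ n) y - (F ^^ n) x \<le> 1 \<longrightarrow>
           (\<Prod>i<n. D ((F ^^ i) y)) \<le> K * q ^ n * (\<Prod>i<n. D ((F ^^ i) x))"
proof -
  have "\<exists>x. \<forall>y. D x \<le> D y"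
    by (rule periodic_continuous_attains_inf) (fact cont per)+
  then obtain x0 where x0: "\<And>y. D x0 \<le> D y"
    by blast
  have "\<exists>x. \<forall>y. - D x \<le> - D y"
    by (rule periodic_continuous_attains_inf) (simp_all add: continuous_on_minus cont per)
  then obtain x1 where x1: "\<And>y. D y \<le> D x1"
    by auto
  \<comment> \<open>The maximum of \<open>D\<close> over its minimum, hence a bound for every ratio
    of two values of \<open>D\<close>.\<close>
  define L where "L = D x1 / D x0"
  have L1: "L \<ge> 1"
    using x0 pos by (simp add: L_def)
  have L: "D y \<le> L * D x" for x y
  proof -
    have "D y \<le> L * D x0"
      using x1 pos [of x0] by (simp add: L_def)
    also have "\<dots> \<le> L * D x"
      using x0 L1 by (intro mult_left_mono) auto
    finally show ?thesis .
  qed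
  \<comment> \<open>Measuring the oscillation against the minimum of \<open>D\<close> turns the
    additive estimate into \<open>D y \<le> q * D x\<close>.\<close>
  have "(q - 1) * D x0 > 0"
    using q pos by simp
  then have "\<exists>\<delta>>0. \<forall>x y. x \<le> y \<and> y - x < \<delta> \<longrightarrow> \<bar>D y - D x\<bar> < (q - 1) * D x0"
    by (rule periodic_continuous_imp_uniformly_continuous [rotated 2]) (fact cont per)+
  then obtain \<delta> where \<delta>: "\<delta> > 0"
    "\<And>x y. x \<le> y \<Longrightarrow> y - x < \<delta> \<Longrightarrow> \<bar>D y - D x\<bar> < (q - 1) * D x0"
    by blast
  have D_le: "D y \<le> q * D x" if "x \<le> y" "y - x < \<delta>" for x y
  proof -
    have "D y \<le> D x + (q - 1) * D x0"
      using \<delta>(2) [OF that] by linarith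
    also have "\<dots> \<le> D x + (q - 1) * D x"
      using x0 q by (intro add_left_mono mult_left_mono) auto
    finally show ?thesis by (simp add: algebra_simps)
  qed
  \<comment> \<open>\<open>J\<close> does not depend on \<open>n\<close>: points with at least
    \<open>J\<close> steps left are within \<open>\<delta>\<close> of each other.\<close>
  obtain J where J: "r ^ J < \<delta> / B"
    using real_arch_pow_inv [of "\<delta> / B" r] \<delta>(1) B r by auto
  have small: "B * r ^ n < \<delta>" if "J \<le> n" for n
  proof -
    have "r ^ n \<le> r ^ J"
      using r that by (intro power_decreasing) auto
    then have "r ^ n < \<delta> / B"
      using J by simp
    with B show ?thesis
      by (simp add: pos_less_divide_eq mult.commute)
  qed
  have prod_nonneg: "(\<Prod>i<n. D ((F ^^ i) z)) \<ge> 0" for n z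
    using pos by (intro prod_nonneg) (auto intro: less_imp_le)
  \<comment> \<open>Induction splits off the first factor and passes to the images of
    \<open>x\<close> and \<open>y\<close>. The exponent \<open>min n J\<close> counts the factors
    with at most \<open>J\<close> steps left, the only ones charged an extra
    \<open>L\<close>.\<close>
  have bound: "(\<Prod>i<n. D ((F ^^ i) y)) \<le> L ^ min n J * q ^ n * (\<Prod>i<n. D ((F ^^ i) x))"
    if "x \<le> y" "(F ^^ n) y - (F ^^ n) x \<le> 1" for n x y
    using that
  proof (induction n arbitrary: x y)
    case (Suc n)
    have IH: "(\<Prod>i<n. D ((F ^^ i) (F y))) \<le> L ^ min n J * q ^ n * (\<Prod>i<n. D ((F ^^ i) (F x)))"
      using Suc.prems monoD [OF mono] by (intro Suc.IH) (simp_all add: funpow_swap1)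
    define c where "c = (if n < J then L else 1)"
    have c: "c \<ge> 1" "L ^ min (Suc n) J = c * L ^ min n J"
      using L1 by (simp_all add: c_def min_def)
    have "D y \<le> c * q * D x"
    proof (cases "n < J")
      case True
      have "D y \<le> L * D x" by (rule L)
      also have "\<dots> \<le> L * q * D x"
        using L1 q pos [of x] by simp
      finally show ?thesis using True by (simp add: c_def)
    next
      case False
      have "y - x \<le> B * r ^ Suc n"
        by (rule contr) (use Suc in auto)
      also have "\<dots> < \<delta>"
        using False by (intro small) auto
      finally show ?thesis
        using D_le Suc.prems(1) False by (simp add: c_def)
    qed
    then have "D y * (\<Prod>i<n. D ((F ^^ i) (F y))) \<le>
        (c * q * D x) * (L ^ min n J * q ^ n * (\<Prod>i<n. D ((F ^^ i) (F x))))"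
      using c q pos [of x] by (intro mult_mono IH prod_nonneg) auto
    then show ?case
      unfolding c(2)
      by (simp add: prod.lessThan_Suc_shift funpow_swap1 mult_ac del: prod.lessThan_Suc)
  qed simp
  have "(\<Prod>i<n. D ((F ^^ i) y)) \<le> L ^ J * q ^ n * (\<Prod>i<n. D ((F ^^ i) x))"
    if "x \<le> y" "(F ^^ n) y - (F ^^ n) x \<le> 1" for n x y
  proof -
    have "L ^ min n J * q ^ n * (\<Prod>i<n. D ((F ^^ i) x)) \<le> L ^ J * q ^ n * (\<Prod>i<n. D ((F ^^ i) x))"
      using L1 q prod_nonneg by (intro mult_right_mono power_increasing) auto
    with bound [OF that] show ?thesis by linarith
  qed
  then show ?thesis
    using L1 by (intro exI [of _ "L ^ J"]) auto
qed

text \<open>All that is kept of the conjugacy is \<open>contr\<close>, the exponential contraction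
  of inverse branches over intervals of length at most 1.\<close>

proposition contracting_branches_imp_expanding:
  fixes F D :: "real \<Rightarrow> real"
  assumes deriv: "\<And>x. (F has_real_derivative D x) (at x)"
    and cont: "continuous_on UNIV D" and per: "\<And>x. D (x + 1) = D x"
    and pos: "\<And>x. D x > 0"
    and mono: "strict_mono F" and surj: "surj F"
    and contr: "\<And>n u v. u \<le> v \<Longrightarrow> (F ^^ n) v - (F ^^ n) u \<le> 1 \<Longrightarrow> v - u \<le> B * r ^ n"
    and r: "0 < r" "r < 1" and B: "B > 0"
  shows "\<exists>C>0. \<exists>l>1. \<forall>x n. C * l ^ n \<le> (\<Prod>i<n. D ((F ^^ i) x))"
proof -
  \<comment> \<open>\<open>q\<^sup>2 * r = 1\<close>: contraction gains \<open>q ^ (2 * n)\<close>,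
    distortion costs \<open>q ^ n\<close>, and growth at rate \<open>q\<close> remains.\<close>
  define q where "q = 1 / sqrt r"
  have q: "q > 1" "q ^ n * (q ^ n * r ^ n) = 1" for n
    using r by (auto simp: q_def simp flip: power_mult_distrib mult.assoc)
  have "\<exists>K>0. \<forall>n x y. x \<le> y \<and> (F ^^ n) y - (F ^^ n) x \<le> 1 \<longrightarrow>
           (\<Prod>i<n. D ((F ^^ i) y)) \<le> K * q ^ n * (\<Prod>i<n. D ((F ^^ i) x))"
    by (rule contracting_branches_imp_distortion [of D F B r q])
      (fact cont per pos strict_mono_mono [OF mono] contr r B q)+
  then obtain K where K: "K > 0" "\<And>n x y. x \<le> y \<Longrightarrow> (F ^^ n) y - (F ^^ n) x \<le> 1 \<Longrightarrow>
           (\<Prod>i<n. D ((F ^^ i) y)) \<le> K * q ^ n * (\<Prod>i<n. D ((F ^^ i) x))"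
    by blast
  have "1 / (B * K) * q ^ n \<le> (\<Prod>i<n. D ((F ^^ i) x))" for x n
  proof -
    have "surj (F ^^ n)"
      using surj by (rule surj_fn)
    then obtain v where v: "(F ^^ n) v = (F ^^ n) x + 1"
      by (metis surjD)
    have smn: "strict_mono (F ^^ n)"
      by (rule strict_mono_funpow [OF mono])
    have "x < v"
      using v strict_mono_less [OF smn, of x v] by simp
    then obtain y where y: "x < y" "y < v"
      "(F ^^ n) v - (F ^^ n) x = (v - x) * (\<Prod>i<n. D ((F ^^ i) y))"
      using MVT2 [of x v "F ^^ n" "\<lambda>y. \<Prod>i<n. D ((F ^^ i) y)"]
        funpow_has_real_derivative [OF deriv] by blast
    have "(F ^^ n) y < (F ^^ n) v"
      using y(2) by (simp add: strict_mono_less [OF smn])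
    then have dist: "(\<Prod>i<n. D ((F ^^ i) y)) \<le> K * q ^ n * (\<Prod>i<n. D ((F ^^ i) x))"
      using v y(1) by (intro K) auto
    have "1 = (v - x) * (\<Prod>i<n. D ((F ^^ i) y))"
      using v y by simp
    also have "\<dots> \<le> (B * r ^ n) * (K * q ^ n * (\<Prod>i<n. D ((F ^^ i) x)))"
      using contr [of x v n] \<open>x < v\<close> v dist pos B r
      by (intro mult_mono) (auto intro!: prod_nonneg intro: less_imp_le)
    finally have "q ^ n * 1 \<le> q ^ n * ((B * r ^ n) * (K * q ^ n * (\<Prod>i<n. D ((F ^^ i) x))))"
      using q(1) by (intro mult_left_mono) auto
    also have "\<dots> = (q ^ n * (q ^ n * r ^ n)) * (B * K * (\<Prod>i<n. D ((F ^^ i) x)))"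
      by (simp add: mult_ac)
    finally show ?thesis
      using B K(1) q(2) by (simp add: field_simps)
  qed
  then show ?thesis
    using B K(1) q(1) by (intro exI [of _ "1 / (B * K)"] conjI exI [of _ q]) auto
qed

section \<open>The conjugacy\<close>

lemma cis_2pi_eq_imp_diff_Ints:
  assumes "cis (2 * pi * a) = cis (2 * pi * b)"
  shows "a - b \<in> \<int>"
proof -
  have "cis (2 * pi * a - 2 * pi * b) = 1"
    by (simp add: assms flip: cis_divide)
  then have "cos (2 * pi * a - 2 * pi * b) = 1"
    by (simp add: complex_eq_iff)
  then obtain n :: int where "2 * pi * a - 2 * pi * b = of_int n * (2 * pi)"
    by (auto simp: cos_one_2pi_int)
  then have "2 * pi * (a - b) = 2 * pi * of_int n"
    by (simp add: algebra_simps)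
  then show ?thesis by simp
qed

text \<open>\<open>is_homeo_lift\<close> does not mention monotonicity. A continuous injection of
  the line is strictly monotone, and comparing the values at 0 and 1 excludes the decreasing
  case.\<close>

lemma homeo_lift_strict_mono:
  assumes "is_homeo_lift h H"
  shows "strict_mono H"
proof -
  have H: "continuous_on UNIV H" "H (0 + 1) = H 0 + 1"
    using assms unfolding is_homeo_lift_def homeomorphism_def by blast+
  have "inj H"
    using assms by (auto simp: is_homeo_lift_def homeomorphism_def intro: inj_on_inverseI)
  then have "strict_mono H \<or> strict_antimono_on UNIV H"
    using injective_eq_monotone_map [of UNIV H] H by simp
  moreover have "\<not> strict_antimono_on UNIV H"
  proof
    assume "strict_antimono_on UNIV H"
    then have "H 1 < H 0"
      by (rule monotone_onD) auto
    with H(2) show False by simp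
  qed
  ultimately show ?thesis by blast
qed

text \<open>\<open>F \<circ> H\<close> and \<open>H \<circ> G\<close> lift the same circle map. The
  integer does not depend on \<open>x\<close>, so it cancels in differences of values of
  \<open>F ^^ n\<close>.\<close>

lemma conjugacy_lift_funpow:
  assumes F: "is_endo_lift d f F" and G: "is_endo_lift e g G" and H: "is_homeo_lift h H"
    and conj: "\<forall>z\<in>unit_circle. f (h z) = h (g z)"
  shows "\<exists>k::int. \<forall>x. (F ^^ n) (H x) = H ((G ^^ n) x) + of_int k"
proof -
  have cis_eq: "cis (2 * pi * F (H x)) = cis (2 * pi * H (G x))" for x
    using F G H conj by (simp add: is_endo_lift_def is_homeo_lift_def)
  \<comment> \<open>Reading \<open>k\<close> off at 0 makes the two lifts agree there, which meets
    the condition at 0 in \<open>continuous_lift_unique\<close>.\<close>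
  obtain k where k: "F (H 0) - H (G 0) = of_int k"
    using cis_2pi_eq_imp_diff_Ints [OF cis_eq] by (metis Ints_cases)
  have cont: "continuous_on UNIV F" "continuous_on UNIV G" "continuous_on UNIV H"
    using F G H by (auto simp: is_endo_lift_def is_homeo_lift_def homeomorphism_def)
  have cont2: "continuous_on UNIV (\<lambda>x. F (H x))" "continuous_on UNIV (\<lambda>x. H (G x) + of_int k)"
    using cont by (auto intro!: continuous_intros intro: continuous_on_compose2)
  have "(\<lambda>x. F (H x)) = (\<lambda>x. H (G x) + of_int k)"
  proof (rule continuous_lift_unique [OF cont2])
    show "cis (2 * pi * F (H x)) = cis (2 * pi * (H (G x) + of_int k))" for x
      using cis_eq by (simp add: distrib_left flip: cis_mult)
  qed (use k in simp)
  then have step: "F (H x) = H (G x) + of_int k" for x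
    by meson
  show ?thesis
  proof (induction n)
    case 0
    show ?case by (intro exI [of _ 0]) simp
  next
    case (Suc n)
    then obtain j :: int where j: "\<And>x. (F ^^ n) (H x) = H ((G ^^ n) x) + of_int j"
      by blast
    have "F (H y + of_int j) = F (H y) + real d * of_int j" for y
      using F by (intro quasiperiodic_add_int [of F "real d"]) (auto simp: is_endo_lift_def)
    then have "(F ^^ Suc n) (H x) = H ((G ^^ Suc n) x) + of_int (k + int d * j)" for x
      using j step by simp
    then show ?case by blast
  qed
qed

text \<open>The interval is pulled back by \<open>H\<close>, its length is bounded by the expansion
  of \<open>G\<close>, and the Hoelder bound carries this forward. Both estimates are given on the
  unit interval only, so the pulled-back interval is cut at an integer if necessary; hence the
  factor 2.\<close>

lemma conjugate_branches_contract:
  assumes F: "is_endo_lift d f F" and G: "is_endo_lift e g G" and e: "e \<ge> 1"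
    and H: "is_homeo_lift h H"
    and conj: "\<forall>z\<in>unit_circle. f (h z) = h (g z)"
    and C: "C > 0" and l: "l > 1"
    and exp: "\<And>x y n. x \<in> {0..1} \<Longrightarrow> y \<in> {0..1} \<Longrightarrow>
      C * l ^ n * \<bar>x - y\<bar> \<le> \<bar>(G ^^ n) x - (G ^^ n) y\<bar>"
    and \<alpha>: "\<alpha> > 0" and A: "A > 0"
    and holder: "\<And>x y. x \<in> {0..1} \<Longrightarrow> y \<in> {0..1} \<Longrightarrow> \<bar>H x - H y\<bar> \<le> A * \<bar>x - y\<bar> powr \<alpha>"
    and uv: "u \<le> v" "(F ^^ n) v - (F ^^ n) u \<le> 1"
  shows "v - u \<le> 2 * A * (1 / C) powr \<alpha> * ((1 / l) powr \<alpha>) ^ n"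
proof -
  define \<epsilon> where "\<epsilon> = A * (1 / C) powr \<alpha> * ((1 / l) powr \<alpha>) ^ n"
  have \<epsilon>: "\<epsilon> > 0"
    using A C l by (auto simp: \<epsilon>_def)
  have Hper: "H (x + 1) = H x + 1" for x
    using H by (simp add: is_homeo_lift_def)
  have Hint: "H (x + of_int m) = H x + of_int m" for x m
    using quasiperiodic_add_int [of H 1] Hper by simp
  have Gint: "(G ^^ n) (x + of_int m) = (G ^^ n) x + real e ^ n * of_int m" for x m
    using G by (intro quasiperiodic_funpow_add_int) (auto simp: is_endo_lift_def)
  have Gmono: "(G ^^ n) x < (G ^^ n) y \<longleftrightarrow> x < y" for x y
    using G by (intro strict_mono_less strict_mono_funpow) (auto simp: is_endo_lift_def)
  \<comment> \<open>Translation by \<open>m\<close> brings a piece between consecutive integers into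
    the unit interval, where \<open>exp\<close> and \<open>holder\<close> apply.\<close>
  have short: "H b - H a \<le> \<epsilon>"
    if ab: "of_int m \<le> a" "a \<le> b" "b \<le> of_int m + 1" and G1: "(G ^^ n) b - (G ^^ n) a \<le> 1" for a b m
  proof -
    define x y where "x = a - of_int m" and "y = b - of_int m"
    have a: "a = x + of_int m" and b: "b = y + of_int m"
      by (auto simp: x_def y_def)
    have xy: "x \<in> {0..1}" "y \<in> {0..1}" "x \<le> y"
      using ab by (auto simp: a b)
    have "C * l ^ n * (y - x) \<le> \<bar>(G ^^ n) y - (G ^^ n) x\<bar>"
      using exp [of y x n] xy by simp
    also have "\<dots> \<le> 1"
      using G1 xy(3) Gmono [of y x] unfolding a b Gint by simp
    finally have "y - x \<le> 1 / C * (1 / l) ^ n"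
      using C l by (simp add: field_simps)
    then have "(y - x) powr \<alpha> \<le> (1 / C * (1 / l) ^ n) powr \<alpha>"
      using xy \<alpha> by (intro powr_mono2) auto
    also have "\<dots> = (1 / C) powr \<alpha> * ((1 / l) ^ n) powr \<alpha>"
      by (rule powr_mult)
    also have "((1 / l) ^ n) powr \<alpha> = ((1 / l) powr \<alpha>) ^ n"
      using l by (simp add: powr_powr mult.commute flip: powr_realpow)
    finally have "A * (y - x) powr \<alpha> \<le> \<epsilon>"
      using A by (simp add: \<epsilon>_def)
    with holder [of y x] xy show ?thesis
      unfolding a b Hint by simp
  qed
  obtain K where K: "homeomorphism UNIV UNIV H K"
    using H by (auto simp: is_homeo_lift_def)
  define a b where "a = K u" and "b = K v"
  have u: "u = H a" and v: "v = H b"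
    using K by (auto simp: a_def b_def homeomorphism_def)
  have smH: "strict_mono H"
    by (rule homeo_lift_strict_mono [OF H])
  have "a \<le> b"
    using uv(1) by (simp add: u v strict_mono_less_eq [OF smH])
  obtain k :: int where k: "\<And>x. (F ^^ n) (H x) = H ((G ^^ n) x) + of_int k"
    using conjugacy_lift_funpow [OF F G H conj] by blast
  \<comment> \<open>The bound 1 on the image length passes from \<open>F ^^ n\<close> to
    \<open>G ^^ n\<close> without loss, because \<open>H\<close> commutes with the unit
    translation.\<close>
  have "H ((G ^^ n) b) \<le> H ((G ^^ n) a + 1)"
    using uv(2) by (simp add: u v k Hper)
  then have G1: "(G ^^ n) b \<le> (G ^^ n) a + 1"
    by (simp add: strict_mono_less_eq [OF smH])
  define m where "m = \<lfloor>a\<rfloor>"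
  have m: "of_int m \<le> a" "a < of_int m + 1"
    by (auto simp: m_def)
  have "v - u \<le> 2 * \<epsilon>"
  proof (cases "b \<le> of_int m + 1")
    case True
    with short [of m a b] m \<open>a \<le> b\<close> G1 \<epsilon> show ?thesis
      by (simp add: u v)
  next
    case False
    define c :: real where "c = of_int m + 1"
    have c: "a < c" "c < b" "c = of_int (m + 1)"
      using m False by (auto simp: c_def)
    \<comment> \<open>\<open>G ^^ n\<close> stretches a unit step to \<open>e ^ n \<ge> 1\<close>,
      so \<open>b \<le> a + 1\<close>, and the single cut at \<open>c\<close> suffices.\<close>
    have "1 \<le> real e ^ n"
      using e by simp
    then have "(G ^^ n) b \<le> (G ^^ n) (a + of_int 1)"
      unfolding Gint using G1 by simp
    then have "b \<le> a + 1"
      using Gmono [of "a + 1" b] by simp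
    then have "H b - H c \<le> \<epsilon>"
      using c m G1 Gmono [of a c] by (intro short [of "m + 1"]) auto
    moreover have "H c - H a \<le> \<epsilon>"
      using c m G1 Gmono [of c b] by (intro short [of m]) auto
    ultimately show ?thesis
      by (simp add: u v)
  qed
  then show ?thesis
    by (simp add: \<epsilon>_def mult.assoc)
qed

text \<open>The hypothesis on \<open>deriv\<close> reads a C1 covering map as a local
  diffeomorphism. The example given before \<open>C1_circle_endomorphism\<close> shows that it
  cannot be dropped.\<close>

theorem theorem1:
  fixes f g :: "complex \<Rightarrow> complex"
  assumes "C1_circle_endomorphism f"
    and "\<forall>x. deriv (endo_lift f) x \<noteq> 0"
    and "topologically_expanding g"
    and "holder_conjugate f g"
  shows "expanding f"
proof -
  obtain d F where F: "is_endo_lift d f F"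
    using assms(1) by (auto simp: C1_circle_endomorphism_def circle_endomorphism_def)
  obtain e G where G: "is_endo_lift e g G" "e \<ge> 2"
    using assms(3) by (auto simp: topologically_expanding_def circle_endomorphism_def)
  obtain h where h: "holder_homeomorphism h" "\<forall>z\<in>unit_circle. f (h z) = h (g z)"
    using assms(4) by (auto simp: holder_conjugate_def)
  obtain H where H: "is_homeo_lift h H"
    using h(1) by (auto simp: holder_homeomorphism_def circle_homeomorphism_def)
  note lifts = endo_lift_eqI [OF F] endo_lift_eqI [OF G(1)] homeo_lift_eqI [OF H]
  obtain C l where C: "C > 0" "l > 1" and exp: "\<And>x y n. x \<in> {0..1} \<Longrightarrow> y \<in> {0..1} \<Longrightarrow>
      C * l ^ n * \<bar>x - y\<bar> \<le> \<bar>(G ^^ n) x - (G ^^ n) y\<bar>"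
    using assms(3) unfolding topologically_expanding_def lifts by metis
  obtain \<alpha> A where \<alpha>: "\<alpha> > 0" and A: "\<And>x y. x \<in> {0..1} \<Longrightarrow> y \<in> {0..1} \<Longrightarrow> x \<noteq> y \<Longrightarrow>
      \<bar>H x - H y\<bar> / \<bar>x - y\<bar> powr \<alpha> \<le> A"
    using h(1) unfolding holder_homeomorphism_def lifts bdd_above_def by blast
  \<comment> \<open>The Hoelder quotient at 1 and 0 equals 1, so \<open>A\<close> is at least
    1.\<close>
  have "H (0 + 1) = H 0 + 1"
    using H unfolding is_homeo_lift_def by blast
  with A [of 1 0] have "A > 0"
    by simp
  \<comment> \<open>The diagonal, excluded from the supremum, is covered because
    \<open>0 powr \<alpha> = 0\<close>.\<close>
  have holder: "\<bar>H x - H y\<bar> \<le> A * \<bar>x - y\<bar> powr \<alpha>" if "x \<in> {0..1}" "y \<in> {0..1}" for x y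
    using A [OF that] by (cases "x = y") (auto simp: field_simps)
  obtain D where D: "\<And>x. (F has_real_derivative D x) (at x)" and cont: "continuous_on UNIV D"
    using assms(1) unfolding C1_circle_endomorphism_def lifts C1_differentiable_on_def
    by (auto simp flip: has_real_derivative_iff_has_vector_derivative)
  have Fper: "F (x + 1) = F x + real d" for x
    using F by (simp add: is_endo_lift_def)
  have per: "D (x + 1) = D x" for x
  proof -
    have "((\<lambda>x. F (x + 1)) has_real_derivative D (x + 1)) (at x)"
      using D [of "x + 1"] by (simp add: DERIV_shift)
    moreover have "((\<lambda>x. F (x + 1)) has_real_derivative D x) (at x)"
      unfolding Fper using DERIV_add [OF D DERIV_const] by simp
    ultimately show ?thesis
      by (rule DERIV_unique)
  qed
  have mono: "strict_mono F"
    using F by (simp add: is_endo_lift_def)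
  \<comment> \<open>Monotonicity gives only the weak inequality; the absence of critical points
    makes it strict.\<close>
  have pos: "D x > 0" for x
  proof -
    have "D x \<ge> 0"
      using mono_on_imp_deriv_nonneg [OF strict_mono_mono [OF mono] D] by simp
    moreover have "D x \<noteq> 0"
      using assms(2) DERIV_imp_deriv [OF D] unfolding lifts by metis
    ultimately show ?thesis by simp
  qed
  have surj: "surj F"
    using F by (auto simp: is_endo_lift_def homeomorphism_def)
  define r where "r = (1 / l) powr \<alpha>"
  define B where "B = 2 * A * (1 / C) powr \<alpha>"
  have r: "0 < r" "r < 1"
    using C \<alpha> by (auto simp: r_def powr_divide)
  have B: "B > 0"
    using \<open>A > 0\<close> C by (simp add: B_def)
  have contr: "v - u \<le> B * r ^ n" if "u \<le> v" "(F ^^ n) v - (F ^^ n) u \<le> 1" for n u v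
    unfolding B_def r_def
    using conjugate_branches_contract [OF F G(1) _ H h(2) C exp \<alpha> \<open>A > 0\<close> holder that] G(2) by simp
  have "\<exists>C>0. \<exists>l>1. \<forall>x n. C * l ^ n \<le> (\<Prod>i<n. D ((F ^^ i) x))"
    by (rule contracting_branches_imp_expanding [of F D B r])
      (fact D cont per pos mono surj contr r B)+
  moreover have "deriv (F ^^ n) x = (\<Prod>i<n. D ((F ^^ i) x))" for n x
    by (rule DERIV_imp_deriv [OF funpow_has_real_derivative [OF D]])
  ultimately show ?thesis
    using assms(1) unfolding expanding_def lifts by metis
qed

end
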